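(* Let $\mathtt{C}$ be a category with objects $\mathtt{C}_0$, and let $\mathtt{I}:\mathtt{C}_0\to\Delta$ be a surjective isomorphism invariant from the objects of $\mathtt{C}$ onto a type $\Delta$. There exists a partial order $\leq$ on $\Delta$, and the function $d_{\mathtt{I}}:\mathtt{C}_0\times\mathtt{C}_0\to[0,\infty]$ given by $(x,y)\mapsto d_{\leq}(\mathtt{I}(x),\mathtt{I}(y))$ is a pseudo-metric on $\mathtt{C}$.
   Context: An isomorphism invariant on $\mathtt{C}$ is a function $\mathtt{I}:\mathtt{C}_0\to\Delta$ such that $x\cong y$ in $\mathtt{C}$ implies $\mathtt{I}(x)=\mathtt{I}(y)$. A "category" means a univalent category: isomorphic objects are regarded as equal. A pseudo-metric on $\mathtt{C}$ is a function $d:\mathtt{C}_0\times\mathtt{C}_0\to[0,\infty]$ such that for all $x,y,z:\mathtt{C}_0$: (i) $d(x,x)=0$ (so, by univalence, $x\cong y$ implies $d(x,y)=0$), (ii) $d(x,y)=d(y,x)$, and (iii) $d(x,y)\leq d(x,z)+d(z,y)$. The partial order in question is the one associated with $\mathtt{I}$ as follows: for $\delta,\epsilon$ in $\Delta$, put $\delta\leq\epsilon$ if there is a finite sequence of morphisms $f_i:x_i\to y_i$ ($1\leq i\leq n$) in $\mathtt{C}$ with $\mathtt{I}(y_i)=\mathtt{I}(x_{i+1})$ for $1\leq i\leq n-1$, $\delta=\mathtt{I}(x_1)$ and $\epsilon=\mathtt{I}(y_n)$; here elements $\delta,\epsilon$ of $\Delta$ with $\delta\leq\epsilon\leq\delta$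 are regarded as equal (equivalently, one passes to the quotient of $\Delta$ by this equivalence relation, on which the pre-order becomes a partial order). For a partial order $\leq$ on $P$, write $p<q$ if $p\leq q$ and $p\neq q$. An element $q$ covers $p$ if $p<q$ and, whenever $p<r\leq q$, one has $r=q$. The cover graph $\mathcal{C}(P)$ is the undirected graph with vertices $P$ and an edge between $p$ and $q$ whenever $q$ covers $p$ or $p$ covers $q$. The graph metric $d_{\leq}:P\times P\to[0,\infty]$ assigns to $(p,q)$ the minimal length of all finite paths in $\mathcal{C}(P)$ between $p$ and $q$, or $\infty$ if there is no such path. *)

theory Defs
  imports "HOL-Library.Extended_Nonnegative_Real"
begin

record ('o, 'm) cat =
  Obj :: "'o set"
  Arr :: "'m set"
  Dom :: "'m \<Rightarrow> 'o"
  Cod :: "'m \<Rightarrow> 'o"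
  Ident :: "'o \<Rightarrow> 'm"
  Comp :: "'m \<Rightarrow> 'm \<Rightarrow> 'm"

text \<open>\<open>Comp C g f\<close> is ``g after f'' and is only meaningful if \<open>Cod C f = Dom C g\<close>.\<close>

locale category =
  fixes C :: "('o, 'm, 'z) cat_scheme"
  assumes Dom_closed: "f \<in> Arr C \<Longrightarrow> Dom C f \<in> Obj C"
    and Cod_closed: "f \<in> Arr C \<Longrightarrow> Cod C f \<in> Obj C"
    and Ident_closed: "x \<in> Obj C \<Longrightarrow> Ident C x \<in> Arr C"
    and Dom_Ident: "x \<in> Obj C \<Longrightarrow> Dom C (Ident C x) = x"
    and Cod_Ident: "x \<in> Obj C \<Longrightarrow> Cod C (Ident C x) = x"
    and Comp_closed:
      "\<lbrakk>f \<in> Arr C; g \<in> Arr C; Cod C f = Dom C g\<rbrakk> \<Longrightarrow> Comp C g f \<in> Arr C"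
    and Dom_Comp:
      "\<lbrakk>f \<in> Arr C; g \<in> Arr C; Cod C f = Dom C g\<rbrakk> \<Longrightarrow> Dom C (Comp C g f) = Dom C f"
    and Cod_Comp:
      "\<lbrakk>f \<in> Arr C; g \<in> Arr C; Cod C f = Dom C g\<rbrakk> \<Longrightarrow> Cod C (Comp C g f) = Cod C g"
    and Comp_Ident_right: "f \<in> Arr C \<Longrightarrow> Comp C f (Ident C (Dom C f)) = f"
    and Comp_Ident_left: "f \<in> Arr C \<Longrightarrow> Comp C (Ident C (Cod C f)) f = f"
    and Comp_assoc:
      "\<lbrakk>f \<in> Arr C; g \<in> Arr C; h \<in> Arr C; Cod C f = Dom C g; Cod C g = Dom C h\<rbrakk>
       \<Longrightarrow> Comp C h (Comp C g f) = Comp C (Comp C h g) f"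

definition isomorphic :: "('o, 'm, 'z) cat_scheme \<Rightarrow> 'o \<Rightarrow> 'o \<Rightarrow> bool" where
  "isomorphic C x y \<longleftrightarrow>
     (\<exists>f\<in>Arr C. \<exists>g\<in>Arr C. Dom C f = x \<and> Cod C f = y \<and> Dom C g = y \<and> Cod C g = x \<and>
        Comp C g f = Ident C x \<and> Comp C f g = Ident C y)"

definition isomorphism_invariant ::
  "('o, 'm, 'z) cat_scheme \<Rightarrow> 'd set \<Rightarrow> ('o \<Rightarrow> 'd) \<Rightarrow> bool" where
  "isomorphism_invariant C \<Delta> I \<longleftrightarrow>
     I \<in> Obj C \<rightarrow> \<Delta> \<and>
     (\<forall>x\<in>Obj C. \<forall>y\<in>Obj C. isomorphic C x y \<longrightarrow> I x = I y)"

text \<open>Univalence (isomorphic objects are identified) is not an axiom of \<open>category\<close>, as it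
  would force set-level categories to be skeletal; instead, invariance under isomorphism is
  built into the notions that depend on it, such as the second conjunct below.\<close>

definition pseudo_metric ::
  "('o, 'm, 'z) cat_scheme \<Rightarrow> ('o \<Rightarrow> 'o \<Rightarrow> ennreal) \<Rightarrow> bool" where
  "pseudo_metric C d \<longleftrightarrow>
     (\<forall>x\<in>Obj C. d x x = 0) \<and>
     (\<forall>x\<in>Obj C. \<forall>y\<in>Obj C. isomorphic C x y \<longrightarrow> d x y = 0) \<and>
     (\<forall>x\<in>Obj C. \<forall>y\<in>Obj C. d x y = d y x) \<and>
     (\<forall>x\<in>Obj C. \<forall>y\<in>Obj C. \<forall>z\<in>Obj C. d x y \<le> d x z + d z y)"

definition invariant_preorder ::
  "('o, 'm, 'z) cat_scheme \<Rightarrow> 'd set \<Rightarrow> ('o \<Rightarrow> 'd) \<Rightarrow> 'd rel" where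
  "invariant_preorder C \<Delta> I =
     {(\<delta>, \<epsilon>) \<in> \<Delta> \<times> \<Delta>. \<exists>fs. fs \<noteq> [] \<and> set fs \<subseteq> Arr C \<and>
        successively (\<lambda>f g. I (Cod C f) = I (Dom C g)) fs \<and>
        \<delta> = I (Dom C (hd fs)) \<and> \<epsilon> = I (Cod C (last fs))}"

definition preorder_equiv :: "'d rel \<Rightarrow> 'd rel" where
  "preorder_equiv r = r \<inter> r\<inverse>"

text \<open>The relation induced by a preorder \<open>r\<close> on the quotient \<open>\<Delta> // preorder_equiv r\<close>.\<close>

definition quotient_order :: "'d set \<Rightarrow> 'd rel \<Rightarrow> 'd set rel" where
  "quotient_order \<Delta> r =
     {(preorder_equiv r `` {\<delta>}, preorder_equiv r `` {\<epsilon>}) | \<delta> \<epsilon>.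
        \<delta> \<in> \<Delta> \<and> \<epsilon> \<in> \<Delta> \<and> (\<delta>, \<epsilon>) \<in> r}"

text \<open>In the following, a partial order on \<open>P\<close> is given by its relation \<open>r\<close>, with
  \<open>(p, q) \<in> r\<close> meaning that \<open>p\<close> is below or equal to \<open>q\<close>; \<open>covers P r q p\<close> says that \<open>q\<close> covers \<open>p\<close>.\<close>

definition covers :: "'p set \<Rightarrow> 'p rel \<Rightarrow> 'p \<Rightarrow> 'p \<Rightarrow> bool" where
  "covers P r q p \<longleftrightarrow>
     p \<in> P \<and> q \<in> P \<and> (p, q) \<in> r \<and> p \<noteq> q \<and>
     (\<forall>s\<in>P. (p, s) \<in> r \<and> p \<noteq> s \<and> (s, q) \<in> r \<longrightarrow> s = q)"

definition cover_graph_edges :: "'p set \<Rightarrow> 'p rel \<Rightarrow> 'p set set" where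
  "cover_graph_edges P r = {{p, q} | p q. covers P r q p \<or> covers P r p q}"

text \<open>Paths in the undirected graph with vertices \<open>V\<close> and edges \<open>E\<close>, as the nonempty list of
  their vertices; the length of a path is its number of edges.\<close>

definition graph_path :: "'p set \<Rightarrow> 'p set set \<Rightarrow> 'p \<Rightarrow> 'p list \<Rightarrow> 'p \<Rightarrow> bool" where
  "graph_path V E p vs q \<longleftrightarrow>
     vs \<noteq> [] \<and> distinct vs \<and> set vs \<subseteq> V \<and> hd vs = p \<and> last vs = q \<and>
     successively (\<lambda>u v. {u, v} \<in> E) vs"

definition graph_metric :: "'p set \<Rightarrow> 'p rel \<Rightarrow> 'p \<Rightarrow> 'p \<Rightarrow> ennreal" where
  "graph_metric P r p q =
     (if \<exists>vs. graph_path P (cover_graph_edges P r) p vs q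
      then of_nat (LEAST n. \<exists>vs. graph_path P (cover_graph_edges P r) p vs q \<and> n = length vs - 1)
      else \<infinity>)"

end

theory Submission
  imports Defs
begin

text \<open>
  A chain of morphisms is a path whose consecutive ends agree only up to \<open>I\<close>. Identities, together
  with surjectivity of \<open>I\<close>, give reflexivity of the induced relation on \<open>\<Delta>\<close>, and concatenation of
  chains gives transitivity; antisymmetry is forced by passing to the quotient, as for every
  preorder.

  The pseudo-metric axioms come from graph theory: in every undirected graph, the length of a
  shortest path is a metric on the vertices, with value \<open>\<infinity>\<close> between components. Symmetry
  comes from reversing paths. For the triangle inequality, two paths are glued at the common
  endpoint. The result is in general only a walk, as it may repeat vertices, but cutting out its
  loops leaves a path that is no longer than the walk (\<open>walk_contains_path\<close>). Finally, isomorphic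
  objects have the same invariant, hence the same class, so that their distance is the distance of
  a vertex from itself.
\<close>

section \<open>Preorders and their quotients\<close>

lemma equiv_preorder_equiv:
  assumes "preorder_on A r"
  shows "equiv A (preorder_equiv r)"
proof (rule equivI)
  show "preorder_equiv r \<subseteq> A \<times> A" and "refl_on A (preorder_equiv r)"
    using assms by (auto simp: preorder_on_def preorder_equiv_def refl_on_def)
  show "sym (preorder_equiv r)"
    by (auto simp: preorder_equiv_def sym_def)
  show "trans (preorder_equiv r)"
    using assms unfolding preorder_on_def preorder_equiv_def
    by (blast intro: transI dest: transD)
qed

text \<open>The quotient order asks for some pair of related representatives; since \<open>r\<close> absorbs its own
  equivalence on both sides, all pairs of representatives are then related.\<close>

lemma quotient_order_iff:
  assumes "preorder_on A r" and "a \<in> A" and "b \<in> A"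
  shows "(preorder_equiv r `` {a}, preorder_equiv r `` {b}) \<in> quotient_order A r \<longleftrightarrow> (a, b) \<in> r"
proof
  assume "(preorder_equiv r `` {a}, preorder_equiv r `` {b}) \<in> quotient_order A r"
  then obtain c d where cd: "c \<in> A" "d \<in> A" "(c, d) \<in> r"
    and eq: "preorder_equiv r `` {a} = preorder_equiv r `` {c}"
      "preorder_equiv r `` {b} = preorder_equiv r `` {d}"
    by (auto simp: quotient_order_def)
  have "(a, c) \<in> preorder_equiv r" "(b, d) \<in> preorder_equiv r"
    using eq cd assms eq_equiv_class_iff[OF equiv_preorder_equiv[OF assms(1)]] by blast+
  then have "(a, c) \<in> r" "(d, b) \<in> r"
    by (auto simp: preorder_equiv_def)
  moreover have "trans r"
    using assms(1) by (simp add: preorder_on_def)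
  ultimately show "(a, b) \<in> r"
    using cd(3) by (meson transD)
next
  assume "(a, b) \<in> r"
  then show "(preorder_equiv r `` {a}, preorder_equiv r `` {b}) \<in> quotient_order A r"
    using assms by (auto simp: quotient_order_def)
qed

lemma partial_order_on_quotient_order:
  assumes pre: "preorder_on A r"
  shows "partial_order_on (A // preorder_equiv r) (quotient_order A r)"
proof -
  let ?c = "\<lambda>a. preorder_equiv r `` {a}" and ?q = "quotient_order A r"
  note iff = quotient_order_iff[OF pre]
  have rel: "?q \<subseteq> (A // preorder_equiv r) \<times> (A // preorder_equiv r)"
    by (auto simp: quotient_order_def quotientI)
  have reps: "\<exists>a\<in>A. X = ?c a" if "(X, Y) \<in> ?q \<or> (Y, X) \<in> ?q" for X Y
    using that by (auto simp: quotient_order_def)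
  have "refl_on (A // preorder_equiv r) ?q"
    using pre iff by (auto simp: refl_on_def preorder_on_def elim!: quotientE)
  moreover have "trans ?q"
  proof (rule transI)
    fix X Y Z assume XY: "(X, Y) \<in> ?q" and YZ: "(Y, Z) \<in> ?q"
    obtain a b c where "a \<in> A" "b \<in> A" "c \<in> A" "X = ?c a" "Y = ?c b" "Z = ?c c"
      using reps XY YZ by metis
    then show "(X, Z) \<in> ?q"
      using XY YZ iff pre unfolding preorder_on_def by (meson transD)
  qed
  moreover have "antisym ?q"
  proof (rule antisymI)
    fix X Y assume XY: "(X, Y) \<in> ?q" and YX: "(Y, X) \<in> ?q"
    obtain a b where ab: "a \<in> A" "b \<in> A" "X = ?c a" "Y = ?c b"
      using reps XY by metis
    then have "(a, b) \<in> preorder_equiv r"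
      using XY YX iff by (simp add: preorder_equiv_def)
    then show "X = Y"
      using ab equiv_class_eq[OF equiv_preorder_equiv[OF pre]] by blast
  qed
  ultimately show ?thesis
    using rel by (simp add: partial_order_on_def preorder_on_def)
qed

section \<open>The graph metric of an order\<close>

text \<open>If a vertex is visited twice, the part of the walk between the two visits can be dropped.
  A walk shortened in this way can be shortened again until no repetition is left.\<close>

lemma walk_contains_path:
  assumes "vs \<noteq> []" and "set vs \<subseteq> V" and "successively (\<lambda>u v. {u, v} \<in> E) vs"
  shows "\<exists>ws. graph_path V E (hd vs) ws (last vs) \<and> length ws \<le> length vs"
  using assms
proof (induction vs rule: length_induct)
  case (1 vs)
  show ?case
  proof (cases "distinct vs")
    case True
    then show ?thesis
      using "1.prems" by (auto simp: graph_path_def)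
  next
    case False
    then obtain xs ys zs y where vs: "vs = xs @ [y] @ ys @ [y] @ zs"
      using not_distinct_decomp by blast
    let ?us = "xs @ [y] @ zs"
    have us: "?us \<noteq> []" "set ?us \<subseteq> V" "successively (\<lambda>u v. {u, v} \<in> E) ?us"
      and ends: "hd ?us = hd vs" "last ?us = last vs"
      and shorter: "length ?us < length vs"
      using "1.prems" by (auto simp: vs successively_append_iff successively_Cons hd_append)
    obtain ws where "graph_path V E (hd ?us) ws (last ?us)" "length ws \<le> length ?us"
      using "1.IH" shorter us by blast
    then show ?thesis
      using ends shorter by (metis less_imp_le order_trans)
  qed
qed

lemma graph_path_rev:
  assumes "graph_path V E p vs q"
  shows "graph_path V E q (rev vs) p"
  using assms by (auto simp: graph_path_def hd_rev last_rev insert_commute)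

text \<open>The shared vertex \<open>q\<close> is listed once, so that the walk obtained by gluing has exactly as many
  edges as the two paths together; the bound is an inequality because its loops are then cut out.\<close>

lemma graph_path_trans:
  assumes "graph_path V E p vs q" and "graph_path V E q ws s"
  shows "\<exists>us. graph_path V E p us s \<and> length us - 1 \<le> (length vs - 1) + (length ws - 1)"
proof -
  obtain ws' where ws: "ws = q # ws'"
    using assms(2) by (cases ws) (auto simp: graph_path_def)
  have vs: "vs \<noteq> []" "set vs \<subseteq> V" "hd vs = p" "last vs = q"
    "successively (\<lambda>u v. {u, v} \<in> E) vs"
    using assms(1) by (auto simp: graph_path_def)
  have ws': "set ws' \<subseteq> V" "last (q # ws') = s" "successively (\<lambda>u v. {u, v} \<in> E) (q # ws')"
    using assms(2) by (auto simp: graph_path_def ws)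
  have "successively (\<lambda>u v. {u, v} \<in> E) (vs @ ws')"
    using vs ws' by (auto simp: successively_append_iff successively_Cons)
  moreover have "hd (vs @ ws') = p" "last (vs @ ws') = s"
    using vs ws' by (auto split: if_splits)
  ultimately obtain us where us: "graph_path V E p us s" "length us \<le> length (vs @ ws')"
    using walk_contains_path[of "vs @ ws'" V E] vs ws' by auto
  moreover have "length us - 1 \<le> (length vs - 1) + (length ws - 1)"
    using us(2) vs(1) by (cases vs) (auto simp: ws)
  ultimately show ?thesis
    by blast
qed

lemma graph_metric_le:
  assumes "graph_path P (cover_graph_edges P r) p vs q"
  shows "graph_metric P r p q \<le> of_nat (length vs - 1)"
proof -
  have "(LEAST n. \<exists>vs. graph_path P (cover_graph_edges P r) p vs q \<and> n = length vs - 1)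
      \<le> length vs - 1"
    using assms by (intro Least_le) blast
  then show ?thesis
    using assms by (auto simp: graph_metric_def)
qed

lemma graph_metric_attained:
  assumes "graph_metric P r p q \<noteq> \<infinity>"
  obtains vs where "graph_path P (cover_graph_edges P r) p vs q"
    and "graph_metric P r p q = of_nat (length vs - 1)"
proof -
  let ?len = "\<lambda>n. \<exists>vs. graph_path P (cover_graph_edges P r) p vs q \<and> n = length vs - 1"
  have ex: "\<exists>vs. graph_path P (cover_graph_edges P r) p vs q"
    using assms by (auto simp: graph_metric_def split: if_splits)
  then have "\<exists>n. ?len n"
    by blast
  then have "?len (LEAST n. ?len n)"
    by (rule LeastI_ex)
  then show thesis
    using ex that by (auto simp: graph_metric_def)
qed

lemma graph_metric_refl:
  assumes "p \<in> P"
  shows "graph_metric P r p p = 0"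
proof -
  have "graph_path P (cover_graph_edges P r) p [p] p"
    using assms by (simp add: graph_path_def)
  from graph_metric_le[OF this] show ?thesis
    by simp
qed

lemma graph_metric_le_commute: "graph_metric P r p q \<le> graph_metric P r q p"
proof (cases "graph_metric P r q p = \<infinity>")
  case False
  then obtain vs where vs: "graph_path P (cover_graph_edges P r) q vs p"
    "graph_metric P r q p = of_nat (length vs - 1)"
    by (rule graph_metric_attained)
  then show ?thesis
    using graph_metric_le[OF graph_path_rev[OF vs(1)]] by simp
qed simp

lemma graph_metric_commute: "graph_metric P r p q = graph_metric P r q p"
  by (intro antisym graph_metric_le_commute)

lemma graph_metric_triangle:
  "graph_metric P r p s \<le> graph_metric P r p q + graph_metric P r q s"
proof (cases "graph_metric P r p q = \<infinity> \<or> graph_metric P r q s = \<infinity>")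
  case False
  obtain vs where vs: "graph_path P (cover_graph_edges P r) p vs q"
    "graph_metric P r p q = of_nat (length vs - 1)"
    using False graph_metric_attained by metis
  obtain ws where ws: "graph_path P (cover_graph_edges P r) q ws s"
    "graph_metric P r q s = of_nat (length ws - 1)"
    using False graph_metric_attained by metis
  obtain us where us: "graph_path P (cover_graph_edges P r) p us s"
    "length us - 1 \<le> (length vs - 1) + (length ws - 1)"
    using graph_path_trans[OF vs(1) ws(1)] by blast
  have "graph_metric P r p s \<le> of_nat (length us - 1)"
    using us(1) by (rule graph_metric_le)
  also have "\<dots> \<le> of_nat ((length vs - 1) + (length ws - 1))"
    using us(2) by (rule of_nat_mono)
  finally show ?thesis
    by (simp only: vs(2) ws(2) of_nat_add)
qed auto

section \<open>The preorder and pseudo-metric of an invariant\<close>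

text \<open>Surjectivity supplies, for each value of the invariant, an object whose identity is a chain
  from that value to itself.\<close>

lemma preorder_on_invariant_preorder:
  assumes "category C" and "I ` Obj C = \<Delta>"
  shows "preorder_on \<Delta> (invariant_preorder C \<Delta> I)"
proof -
  interpret category C by fact
  let ?r = "invariant_preorder C \<Delta> I"
  have "?r \<subseteq> \<Delta> \<times> \<Delta>"
    by (auto simp: invariant_preorder_def)
  moreover have "refl_on \<Delta> ?r"
  proof (rule refl_onI)
    fix \<delta> assume "\<delta> \<in> \<Delta>"
    then obtain x where x: "x \<in> Obj C" "\<delta> = I x"
      using assms(2) by blast
    show "(\<delta>, \<delta>) \<in> ?r"
      using x \<open>\<delta> \<in> \<Delta>\<close> unfolding invariant_preorder_def
      by (auto simp: Ident_closed Dom_Ident Cod_Ident intro!: exI[of _ "[Ident C x]"])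
  qed
  moreover have "trans ?r"
  proof (rule transI)
    fix \<delta> \<epsilon> \<zeta> assume "(\<delta>, \<epsilon>) \<in> ?r" "(\<epsilon>, \<zeta>) \<in> ?r"
    then obtain fs gs where "\<delta> \<in> \<Delta>" "\<zeta> \<in> \<Delta>"
      and fs: "fs \<noteq> []" "set fs \<subseteq> Arr C" "\<delta> = I (Dom C (hd fs))" "\<epsilon> = I (Cod C (last fs))"
        "successively (\<lambda>f g. I (Cod C f) = I (Dom C g)) fs"
      and gs: "gs \<noteq> []" "set gs \<subseteq> Arr C" "\<epsilon> = I (Dom C (hd gs))" "\<zeta> = I (Cod C (last gs))"
        "successively (\<lambda>f g. I (Cod C f) = I (Dom C g)) gs"
      by (auto simp: invariant_preorder_def)
    then show "(\<delta>, \<zeta>) \<in> ?r"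
      unfolding invariant_preorder_def
      by (auto simp: successively_append_iff intro!: exI[of _ "fs @ gs"])
  qed
  ultimately show ?thesis
    by (simp add: preorder_on_def)
qed

lemma pseudo_metric_graph_metric:
  assumes "\<And>x. x \<in> Obj C \<Longrightarrow> F x \<in> P"
    and "\<And>x y. \<lbrakk>x \<in> Obj C; y \<in> Obj C; isomorphic C x y\<rbrakk> \<Longrightarrow> F x = F y"
  shows "pseudo_metric C (\<lambda>x y. graph_metric P r (F x) (F y))"
  unfolding pseudo_metric_def
proof (intro conjI ballI impI)
  show "graph_metric P r (F x) (F y) = 0" if "x \<in> Obj C" "y \<in> Obj C" "isomorphic C x y" for x y
    using that assms by (metis graph_metric_refl)
qed (simp_all add: assms graph_metric_refl graph_metric_triangle,
     simp add: graph_metric_commute)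

theorem corollary4:
  fixes C :: "('o, 'm, 'z) cat_scheme"
    and \<Delta> :: "'d set"
    and I :: "'o \<Rightarrow> 'd"
  defines "r \<equiv> invariant_preorder C \<Delta> I"
  defines "Q \<equiv> \<Delta> // preorder_equiv r"
  defines "cls \<equiv> (\<lambda>\<delta>. preorder_equiv r `` {\<delta>})"
  assumes "category C"
    and "isomorphism_invariant C \<Delta> I"
    and "I ` Obj C = \<Delta>"
  shows "preorder_on \<Delta> r \<and> equiv \<Delta> (preorder_equiv r) \<and>
    partial_order_on Q (quotient_order \<Delta> r) \<and>
    (\<forall>\<delta>\<in>\<Delta>. \<forall>\<epsilon>\<in>\<Delta>. (cls \<delta>, cls \<epsilon>) \<in> quotient_order \<Delta> r \<longleftrightarrow> (\<delta>, \<epsilon>) \<in> r) \<and>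
    pseudo_metric C (\<lambda>x y. graph_metric Q (quotient_order \<Delta> r) (cls (I x)) (cls (I y)))"
proof (intro conjI ballI)
  show pre: "preorder_on \<Delta> r"
    unfolding r_def using assms by (intro preorder_on_invariant_preorder)
  then show "equiv \<Delta> (preorder_equiv r)"
    by (rule equiv_preorder_equiv)
  show "partial_order_on Q (quotient_order \<Delta> r)"
    unfolding Q_def using pre by (rule partial_order_on_quotient_order)
  show "(cls \<delta>, cls \<epsilon>) \<in> quotient_order \<Delta> r \<longleftrightarrow> (\<delta>, \<epsilon>) \<in> r" if "\<delta> \<in> \<Delta>" "\<epsilon> \<in> \<Delta>" for \<delta> \<epsilon>
    unfolding cls_def using pre that by (rule quotient_order_iff)
  show "pseudo_metric C (\<lambda>x y. graph_metric Q (quotient_order \<Delta> r) (cls (I x)) (cls (I y)))"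
  proof (rule pseudo_metric_graph_metric)
    show "cls (I x) \<in> Q" if "x \<in> Obj C" for x
      unfolding cls_def Q_def using that assms(6) by (auto intro: quotientI)
    show "cls (I x) = cls (I y)" if "x \<in> Obj C" "y \<in> Obj C" "isomorphic C x y" for x y
      using that assms(5) by (simp add: isomorphism_invariant_def)
  qed
qed

end
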